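(* Let $(X,A_\tau,\rightarrow)$ be a labelled transition system. The branching apartness relation $\mathrel{\#_b}$ on $X$ is a proper apartness relation, i.e. it is irreflexive ($\neg(x \mathrel{\#_b} x)$ for all $x$), symmetric ($x\mathrel{\#_b} y \Rightarrow y \mathrel{\#_b} x$) and co-transitive (for all $x,y,z$: $x \mathrel{\#_b} y \Rightarrow (x\mathrel{\#_b} z \vee z\mathrel{\#_b} y)$).
   Context: A labelled transition system (LTS) is a triple $(X,A_\tau,\rightarrow)$ with $X$ a set of states, $A_\tau=A\cup\{\tau\}$ a set of actions where $\tau\notin A$ is the silent action, and $\rightarrow\subseteq X\times A_\tau\times X$; write $q\rightarrow_u q'$ for $(q,u,q')\in\rightarrow$. The letter $a$ always ranges over $A$ (so $a\neq\tau$). Write $\twoheadrightarrow_\tau$ for the reflexive-transitive closure of $\rightarrow_\tau$. A relation $Q\subseteq X\times X$ is a branching apartness if it satisfies: (symm) $Q(p,q)\Rightarrow Q(q,p)$; (in$_{b\tau}$) if $q\rightarrow_\tau q'$, $Q(q',p)$, and for all $p',p''$ with $p\twoheadrightarrow_\tau p'\rightarrow_\tau p''$ we have $Q(q,p')\vee Q(q',p'')$, then $Q(q,p)$; (in$_b$) for each $a\in A$: if $q\rightarrow_a q'$ and for all $p',p''$ with $p\twoheadrightarrow_\tau p'\rightarrow_a p''$ we have $Q(q,p')\vee Q(q',p'')$, then $Q(q,p)$. States $q,p$ are branching apart, $q\mathrel{\#_b} p$, if $Q(q,p)$ holds for every branching apartness $Q$. *)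

theory Defs
  imports Main
begin

text \<open>A labelled transition system with state set \<open>X\<close>, visible actions \<open>A\<close>, silent action \<open>\<tau>\<close> and
  transition relation \<open>T\<close>; \<open>A\<^sub>\<tau>\<close> is \<open>insert \<tau> A\<close>.\<close>

locale lts =
  fixes X :: "'x set" and A :: "'l set" and \<tau> :: 'l and T :: "('x \<times> 'l \<times> 'x) set"
  assumes tau_notin: "\<tau> \<notin> A"
    and T_subset: "T \<subseteq> X \<times> insert \<tau> A \<times> X"

definition step :: "('x \<times> 'l \<times> 'x) set \<Rightarrow> 'l \<Rightarrow> ('x \<times> 'x) set" where
  "step T u = {(q, q'). (q, u, q') \<in> T}"

definition branching_apartness ::
  "'x set \<Rightarrow> 'l set \<Rightarrow> 'l \<Rightarrow> ('x \<times> 'l \<times> 'x) set \<Rightarrow> ('x \<times> 'x) set \<Rightarrow> bool" where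
  "branching_apartness X A \<tau> T Q \<longleftrightarrow>
     Q \<subseteq> X \<times> X \<and>
     sym Q \<and>
     (\<forall>q\<in>X. \<forall>q'\<in>X. \<forall>p\<in>X.
        (q, q') \<in> step T \<tau> \<longrightarrow> (q', p) \<in> Q \<longrightarrow>
        (\<forall>p'\<in>X. \<forall>p''\<in>X. (p, p') \<in> (step T \<tau>)\<^sup>* \<longrightarrow> (p', p'') \<in> step T \<tau> \<longrightarrow>
            (q, p') \<in> Q \<or> (q', p'') \<in> Q) \<longrightarrow>
        (q, p) \<in> Q) \<and>
     (\<forall>a\<in>A. \<forall>q\<in>X. \<forall>q'\<in>X. \<forall>p\<in>X.
        (q, q') \<in> step T a \<longrightarrow>
        (\<forall>p'\<in>X. \<forall>p''\<in>X. (p, p') \<in> (step T \<tau>)\<^sup>* \<longrightarrow> (p', p'') \<in> step T a \<longrightarrow>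
            (q, p') \<in> Q \<or> (q', p'') \<in> Q) \<longrightarrow>
        (q, p) \<in> Q)"

definition branching_apart ::
  "'x set \<Rightarrow> 'l set \<Rightarrow> 'l \<Rightarrow> ('x \<times> 'l \<times> 'x) set \<Rightarrow> ('x \<times> 'x) set" where
  "branching_apart X A \<tau> T =
     {(q, p) \<in> X \<times> X. \<forall>Q. branching_apartness X A \<tau> T Q \<longrightarrow> (q, p) \<in> Q}"

definition cotrans_on :: "'x set \<Rightarrow> ('x \<times> 'x) set \<Rightarrow> bool" where
  "cotrans_on X R \<longleftrightarrow>
     (\<forall>x\<in>X. \<forall>y\<in>X. \<forall>z\<in>X. (x, y) \<in> R \<longrightarrow> (x, z) \<in> R \<or> (z, y) \<in> R)"

definition proper_apartness_on :: "'x set \<Rightarrow> ('x \<times> 'x) set \<Rightarrow> bool" where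
  "proper_apartness_on X R \<longleftrightarrow>
     R \<subseteq> X \<times> X \<and> irrefl_on X R \<and> sym_on X R \<and> cotrans_on X R"

end

theory Submission
  imports Defs
begin

text \<open>Branching apartness is the complement of branching bisimilarity, so co-transitivity is
  transitivity of the latter. Branching bisimulations are not closed under composition; following
  Basten, one passes to semi-branching bisimulations, which are. Their largest one is therefore an
  equivalence, and it has the stuttering property: if \<open>p\<close> and \<open>r\<close> are related, so is every state
  on a silent path from \<open>p\<close> to \<open>r\<close>. By stuttering it is itself a branching bisimulation, whence its
  complement is the least branching apartness.\<close>

text \<open>Compared with a branching bisimulation, the silent clause is weaker: an answer without a
  final step may still move, relating \<open>q\<close> and \<open>q'\<close> to a state
  \<open>p'\<close> silently reachable from \<open>p\<close> instead of to \<open>p\<close> itself.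
  States range over the whole type, so \<open>Id\<close> qualifies as it stands; \<open>X\<close>
  enters only with complements.\<close>

definition semi_bisimulation :: "'l set \<Rightarrow> 'l \<Rightarrow> ('x \<times> 'l \<times> 'x) set \<Rightarrow> ('x \<times> 'x) set \<Rightarrow> bool" where
  "semi_bisimulation A \<tau> T S \<longleftrightarrow>
     sym S \<and>
     (\<forall>q p q'. (q, p) \<in> S \<longrightarrow> (q, q') \<in> step T \<tau> \<longrightarrow>
        (\<exists>p'. (p, p') \<in> (step T \<tau>)\<^sup>* \<and> (q, p') \<in> S \<and>
           ((q', p') \<in> S \<or> (\<exists>p''. (p', p'') \<in> step T \<tau> \<and> (q', p'') \<in> S)))) \<and>
     (\<forall>a\<in>A. \<forall>q p q'. (q, p) \<in> S \<longrightarrow> (q, q') \<in> step T a \<longrightarrow>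
        (\<exists>p' p''. (p, p') \<in> (step T \<tau>)\<^sup>* \<and> (q, p') \<in> S \<and>
           (p', p'') \<in> step T a \<and> (q', p'') \<in> S))"

definition semi_bisimilar :: "'l set \<Rightarrow> 'l \<Rightarrow> ('x \<times> 'l \<times> 'x) set \<Rightarrow> ('x \<times> 'x) set" where
  "semi_bisimilar A \<tau> T = \<Union> {S. semi_bisimulation A \<tau> T S}"

lemma semi_bisimulationI:
  assumes "sym S"
    and "\<And>q p q'. (q, p) \<in> S \<Longrightarrow> (q, q') \<in> step T \<tau> \<Longrightarrow>
        \<exists>p'. (p, p') \<in> (step T \<tau>)\<^sup>* \<and> (q, p') \<in> S \<and>
           ((q', p') \<in> S \<or> (\<exists>p''. (p', p'') \<in> step T \<tau> \<and> (q', p'') \<in> S))"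
    and "\<And>a q p q'. a \<in> A \<Longrightarrow> (q, p) \<in> S \<Longrightarrow> (q, q') \<in> step T a \<Longrightarrow>
        \<exists>p' p''. (p, p') \<in> (step T \<tau>)\<^sup>* \<and> (q, p') \<in> S \<and> (p', p'') \<in> step T a \<and> (q', p'') \<in> S"
  shows "semi_bisimulation A \<tau> T S"
  using assms unfolding semi_bisimulation_def by blast

lemma semi_bisimulation_sym: "semi_bisimulation A \<tau> T S \<Longrightarrow> sym S"
  unfolding semi_bisimulation_def by blast

lemma semi_bisimulation_tau:
  assumes "semi_bisimulation A \<tau> T S" "(q, p) \<in> S" "(q, q') \<in> step T \<tau>"
  obtains p' where "(p, p') \<in> (step T \<tau>)\<^sup>*" "(q, p') \<in> S"
    "(q', p') \<in> S \<or> (\<exists>p''. (p', p'') \<in> step T \<tau> \<and> (q', p'') \<in> S)"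
  using assms unfolding semi_bisimulation_def by meson

lemma semi_bisimulation_visible:
  assumes "semi_bisimulation A \<tau> T S" "a \<in> A" "(q, p) \<in> S" "(q, q') \<in> step T a"
  obtains p' p'' where "(p, p') \<in> (step T \<tau>)\<^sup>*" "(q, p') \<in> S"
    "(p', p'') \<in> step T a" "(q', p'') \<in> S"
  using assms unfolding semi_bisimulation_def by meson

text \<open>Induction on the path, answering one silent step at a time. It carries the silent prefix
  of an answer across a second relation when relations are composed.\<close>

lemma semi_bisimulation_tau_rtrancl:
  assumes S: "semi_bisimulation A \<tau> T S" and "(q, q') \<in> (step T \<tau>)\<^sup>*" and "(q, p) \<in> S"
  obtains p' where "(p, p') \<in> (step T \<tau>)\<^sup>*" "(q', p') \<in> S"
proof -
  from assms(2) have "\<exists>p'. (p, p') \<in> (step T \<tau>)\<^sup>* \<and> (q', p') \<in> S"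
  proof (induction rule: rtrancl_induct)
    case base
    then show ?case using assms(3) by blast
  next
    case (step r r')
    then obtain s where s: "(p, s) \<in> (step T \<tau>)\<^sup>*" "(r, s) \<in> S" by blast
    obtain p' where "(s, p') \<in> (step T \<tau>)\<^sup>*"
      "(r', p') \<in> S \<or> (\<exists>p''. (p', p'') \<in> step T \<tau> \<and> (r', p'') \<in> S)"
      using semi_bisimulation_tau[OF S s(2) step(2)] by metis
    with s(1) show ?case
      by (meson rtrancl_trans rtrancl_into_rtrancl)
  qed
  with that show thesis by blast
qed

lemma semi_bisimilarI: "semi_bisimulation A \<tau> T S \<Longrightarrow> (p, q) \<in> S \<Longrightarrow> (p, q) \<in> semi_bisimilar A \<tau> T"
  unfolding semi_bisimilar_def by blast

lemma semi_bisimulation_semi_bisimilar: "semi_bisimulation A \<tau> T (semi_bisimilar A \<tau> T)"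
proof (rule semi_bisimulationI)
  show "sym (semi_bisimilar A \<tau> T)"
    unfolding semi_bisimilar_def by (rule symI) (blast dest: semi_bisimulation_sym symD)
next
  fix q p q' assume "(q, p) \<in> semi_bisimilar A \<tau> T" and st: "(q, q') \<in> step T \<tau>"
  then obtain S where S: "semi_bisimulation A \<tau> T S" "(q, p) \<in> S"
    unfolding semi_bisimilar_def by blast
  show "\<exists>p'. (p, p') \<in> (step T \<tau>)\<^sup>* \<and> (q, p') \<in> semi_bisimilar A \<tau> T \<and>
      ((q', p') \<in> semi_bisimilar A \<tau> T \<or>
       (\<exists>p''. (p', p'') \<in> step T \<tau> \<and> (q', p'') \<in> semi_bisimilar A \<tau> T))"
    using semi_bisimulation_tau[OF S st] semi_bisimilarI[OF S(1)] by metis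
next
  fix a q p q' assume a: "a \<in> A" and "(q, p) \<in> semi_bisimilar A \<tau> T" and st: "(q, q') \<in> step T a"
  then obtain S where S: "semi_bisimulation A \<tau> T S" "(q, p) \<in> S"
    unfolding semi_bisimilar_def by blast
  show "\<exists>p' p''. (p, p') \<in> (step T \<tau>)\<^sup>* \<and> (q, p') \<in> semi_bisimilar A \<tau> T \<and>
      (p', p'') \<in> step T a \<and> (q', p'') \<in> semi_bisimilar A \<tau> T"
    using semi_bisimulation_visible[OF S(1) a S(2) st] semi_bisimilarI[OF S(1)] by metis
qed

section \<open>Closure under composition\<close>

lemma semi_bisimulation_Id: "semi_bisimulation A \<tau> T Id"
  by (rule semi_bisimulationI) (auto simp: sym_Id)

text \<open>The middle state \<open>r\<close> answers the move of \<open>q\<close>; the silent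
  prefix of that answer is followed from \<open>p\<close> up to \<open>s\<close>, and its last step
  is then answered from \<open>s\<close>. Composing \<open>S\<close> with itself keeps
  symmetry.\<close>

lemma semi_bisimulation_relcomp:
  assumes S: "semi_bisimulation A \<tau> T S"
  shows "semi_bisimulation A \<tau> T (S O S)"
proof (rule semi_bisimulationI)
  show "sym (S O S)"
    using semi_bisimulation_sym[OF S] by (auto intro!: symI dest: symD)
next
  fix q p q' assume "(q, p) \<in> S O S" and st: "(q, q') \<in> step T \<tau>"
  then obtain r where r: "(q, r) \<in> S" "(r, p) \<in> S" by blast
  obtain r' where r': "(r, r') \<in> (step T \<tau>)\<^sup>*" "(q, r') \<in> S"
    "(q', r') \<in> S \<or> (\<exists>r''. (r', r'') \<in> step T \<tau> \<and> (q', r'') \<in> S)"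
    using semi_bisimulation_tau[OF S r(1) st] .
  obtain s where s: "(p, s) \<in> (step T \<tau>)\<^sup>*" "(r', s) \<in> S"
    using semi_bisimulation_tau_rtrancl[OF S r'(1) r(2)] .
  from r'(3) show "\<exists>p'. (p, p') \<in> (step T \<tau>)\<^sup>* \<and> (q, p') \<in> S O S \<and>
      ((q', p') \<in> S O S \<or> (\<exists>p''. (p', p'') \<in> step T \<tau> \<and> (q', p'') \<in> S O S))"
  proof
    assume "(q', r') \<in> S"
    then show ?thesis using s r'(2) by blast
  next
    assume "\<exists>r''. (r', r'') \<in> step T \<tau> \<and> (q', r'') \<in> S"
    then obtain r'' where r'': "(r', r'') \<in> step T \<tau>" "(q', r'') \<in> S" by blast
    obtain p' where p': "(s, p') \<in> (step T \<tau>)\<^sup>*" "(r', p') \<in> S"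
      "(r'', p') \<in> S \<or> (\<exists>p''. (p', p'') \<in> step T \<tau> \<and> (r'', p'') \<in> S)"
      using semi_bisimulation_tau[OF S s(2) r''(1)] .
    have "(p, p') \<in> (step T \<tau>)\<^sup>*" using s(1) p'(1) by (rule rtrancl_trans)
    \<comment> \<open>If \<open>r''\<close> is related to \<open>p'\<close> itself, the composite
      answer has no final step although \<open>p'\<close> may differ from \<open>p\<close>. The weak
      silent clause admits exactly this.\<close>
    then show ?thesis using p'(2,3) r'(2) r''(2) by blast
  qed
next
  fix a q p q' assume a: "a \<in> A" and "(q, p) \<in> S O S" and st: "(q, q') \<in> step T a"
  then obtain r where r: "(q, r) \<in> S" "(r, p) \<in> S" by blast
  obtain r' r'' where r': "(r, r') \<in> (step T \<tau>)\<^sup>*" "(q, r') \<in> S"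
    "(r', r'') \<in> step T a" "(q', r'') \<in> S"
    using semi_bisimulation_visible[OF S a r(1) st] .
  obtain s where s: "(p, s) \<in> (step T \<tau>)\<^sup>*" "(r', s) \<in> S"
    using semi_bisimulation_tau_rtrancl[OF S r'(1) r(2)] .
  obtain p' p'' where p': "(s, p') \<in> (step T \<tau>)\<^sup>*" "(r', p') \<in> S"
    "(p', p'') \<in> step T a" "(r'', p'') \<in> S"
    using semi_bisimulation_visible[OF S a s(2) r'(3)] .
  have "(p, p') \<in> (step T \<tau>)\<^sup>*" using s(1) p'(1) by (rule rtrancl_trans)
  then show "\<exists>p' p''. (p, p') \<in> (step T \<tau>)\<^sup>* \<and> (q, p') \<in> S O S \<and>
      (p', p'') \<in> step T a \<and> (q', p'') \<in> S O S"
    using p' r' by blast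
qed

section \<open>Equivalence and stuttering of the largest semi-branching bisimulation\<close>

lemma semi_bisimilar_refl: "(p, p) \<in> semi_bisimilar A \<tau> T"
  by (rule semi_bisimilarI[OF semi_bisimulation_Id]) simp

lemma semi_bisimilar_sym: "(p, q) \<in> semi_bisimilar A \<tau> T \<Longrightarrow> (q, p) \<in> semi_bisimilar A \<tau> T"
  using semi_bisimulation_sym[OF semi_bisimulation_semi_bisimilar] by (rule symD)

lemma semi_bisimilar_trans:
  "(p, q) \<in> semi_bisimilar A \<tau> T \<Longrightarrow> (q, r) \<in> semi_bisimilar A \<tau> T \<Longrightarrow> (p, r) \<in> semi_bisimilar A \<tau> T"
  by (rule semi_bisimilarI[OF semi_bisimulation_relcomp[OF semi_bisimulation_semi_bisimilar]]) blast

text \<open>Adding the pair and its converse to the largest semi-branching bisimulation gives a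
  semi-branching bisimulation again, so the pair was already there. A move of \<open>p\<close> is
  answered by \<open>r\<close> going silently to \<open>s\<close> and then answering as
  \<open>s\<close> does.\<close>

lemma semi_bisimilar_stuttering:
  assumes "(p, r) \<in> (step T \<tau>)\<^sup>*" "(r, s) \<in> (step T \<tau>)\<^sup>*" "(p, s) \<in> semi_bisimilar A \<tau> T"
  shows "(p, r) \<in> semi_bisimilar A \<tau> T"
proof -
  let ?B = "semi_bisimilar A \<tau> T"
  let ?S = "?B \<union> {(p, r), (r, p)}"
  note B = semi_bisimulation_semi_bisimilar[of A \<tau> T]
  have "semi_bisimulation A \<tau> T ?S"
  proof (rule semi_bisimulationI)
    show "sym ?S" by (auto intro!: symI dest: semi_bisimilar_sym)
  next
    fix q t q' assume qt: "(q, t) \<in> ?S" and st: "(q, q') \<in> step T \<tau>"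
    consider "(q, t) \<in> ?B" | "q = p" "t = r" | "q = r" "t = p" using qt by blast
    then show "\<exists>p'. (t, p') \<in> (step T \<tau>)\<^sup>* \<and> (q, p') \<in> ?S \<and>
        ((q', p') \<in> ?S \<or> (\<exists>p''. (p', p'') \<in> step T \<tau> \<and> (q', p'') \<in> ?S))"
    proof cases
      case 1
      then show ?thesis using semi_bisimulation_tau[OF B 1 st] by (metis UnI1)
    next
      case 2
      then obtain p' where "(s, p') \<in> (step T \<tau>)\<^sup>*" "(q, p') \<in> ?B"
        "(q', p') \<in> ?B \<or> (\<exists>p''. (p', p'') \<in> step T \<tau> \<and> (q', p'') \<in> ?B)"
        using semi_bisimulation_tau[OF B assms(3)] st by metis
      then show ?thesis using 2 assms(2) by (metis UnI1 rtrancl_trans)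
    next
      case 3
      \<comment> \<open>Here \<open>p\<close> walks silently to \<open>r\<close> and copies the
        move, so reflexivity relates sources and targets.\<close>
      then show ?thesis using assms(1) st by (metis UnI1 semi_bisimilar_refl)
    qed
  next
    fix a q t q' assume a: "a \<in> A" and qt: "(q, t) \<in> ?S" and st: "(q, q') \<in> step T a"
    consider "(q, t) \<in> ?B" | "q = p" "t = r" | "q = r" "t = p" using qt by blast
    then show "\<exists>p' p''. (t, p') \<in> (step T \<tau>)\<^sup>* \<and> (q, p') \<in> ?S \<and>
        (p', p'') \<in> step T a \<and> (q', p'') \<in> ?S"
    proof cases
      case 1
      then show ?thesis using semi_bisimulation_visible[OF B a 1 st] by (metis UnI1)
    next
      case 2
      then obtain p' p'' where "(s, p') \<in> (step T \<tau>)\<^sup>*" "(q, p') \<in> ?B"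
        "(p', p'') \<in> step T a" "(q', p'') \<in> ?B"
        using semi_bisimulation_visible[OF B a assms(3)] st by metis
      then show ?thesis using 2 assms(2) by (metis UnI1 rtrancl_trans)
    next
      case 3
      then show ?thesis using assms(1) st by (metis UnI1 semi_bisimilar_refl)
    qed
  qed
  then show ?thesis by (rule semi_bisimilarI) simp
qed

text \<open>An answer without a final step can be cut before its last silent step: that step becomes
  the answering one, and stuttering keeps its source related to \<open>q\<close>.\<close>

lemma semi_bisimilar_branching:
  assumes "(q, p) \<in> semi_bisimilar A \<tau> T" "(q, q') \<in> step T \<tau>" "(q', p) \<notin> semi_bisimilar A \<tau> T"
  obtains p' p'' where "(p, p') \<in> (step T \<tau>)\<^sup>*" "(p', p'') \<in> step T \<tau>"
    "(q, p') \<in> semi_bisimilar A \<tau> T" "(q', p'') \<in> semi_bisimilar A \<tau> T"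
proof -
  let ?B = "semi_bisimilar A \<tau> T"
  obtain s where s: "(p, s) \<in> (step T \<tau>)\<^sup>*" "(q, s) \<in> ?B"
    "(q', s) \<in> ?B \<or> (\<exists>p''. (s, p'') \<in> step T \<tau> \<and> (q', p'') \<in> ?B)"
    using semi_bisimulation_tau[OF semi_bisimulation_semi_bisimilar assms(1,2)] .
  show thesis
  proof (cases "(q', s) \<in> ?B")
    case True
    \<comment> \<open>Since \<open>q'\<close> is related to \<open>s\<close> but not to
      \<open>p\<close>, the path from \<open>p\<close> to \<open>s\<close> has a last step.\<close>
    with assms(3) have "p \<noteq> s" by blast
    with s(1) obtain p' where p': "(p, p') \<in> (step T \<tau>)\<^sup>*" "(p', s) \<in> step T \<tau>"
      by (meson rtranclE)
    have "(p, s) \<in> ?B"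
      using semi_bisimilar_trans[OF semi_bisimilar_sym[OF assms(1)] s(2)] .
    then have "(p, p') \<in> ?B"
      using p' by (blast intro: semi_bisimilar_stuttering)
    then have "(q, p') \<in> ?B" by (rule semi_bisimilar_trans[OF assms(1)])
    with p' True that show thesis by blast
  next
    case False
    with s that show thesis by blast
  qed
qed

section \<open>Complements and branching apartness\<close>

context lts
begin

lemma step_in_states: "(q, q') \<in> step T u \<Longrightarrow> q \<in> X \<and> q' \<in> X"
  using T_subset unfolding step_def by blast

text \<open>By contraposition: if \<open>q\<close> and \<open>p\<close> were semi-bisimilar, the
  answer of \<open>p\<close> would refute both disjuncts of the rule. In the silent rule, the
  premise on \<open>q'\<close> and \<open>p\<close> is what lets
  \<open>semi_bisimilar_branching\<close> supply a genuine step.\<close>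

lemma branching_apartness_compl_semi_bisimilar:
  "branching_apartness X A \<tau> T (X \<times> X - semi_bisimilar A \<tau> T)"
  unfolding branching_apartness_def
proof (intro conjI ballI impI)
  show "sym (X \<times> X - semi_bisimilar A \<tau> T)"
    by (auto intro!: symI dest: semi_bisimilar_sym)
next
  fix q q' p
  assume X: "q \<in> X" "p \<in> X" and st: "(q, q') \<in> step T \<tau>"
    and q'p: "(q', p) \<in> X \<times> X - semi_bisimilar A \<tau> T"
    and all: "\<forall>p'\<in>X. \<forall>p''\<in>X. (p, p') \<in> (step T \<tau>)\<^sup>* \<longrightarrow> (p', p'') \<in> step T \<tau> \<longrightarrow>
      (q, p') \<in> X \<times> X - semi_bisimilar A \<tau> T \<or> (q', p'') \<in> X \<times> X - semi_bisimilar A \<tau> T"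
  have "(q, p) \<notin> semi_bisimilar A \<tau> T"
  proof
    assume "(q, p) \<in> semi_bisimilar A \<tau> T"
    then show False
      using semi_bisimilar_branching[OF _ st] q'p all step_in_states by (metis DiffD2)
  qed
  with X show "(q, p) \<in> X \<times> X - semi_bisimilar A \<tau> T" by blast
next
  fix a q q' p
  assume a: "a \<in> A" and X: "q \<in> X" "p \<in> X" and st: "(q, q') \<in> step T a"
    and all: "\<forall>p'\<in>X. \<forall>p''\<in>X. (p, p') \<in> (step T \<tau>)\<^sup>* \<longrightarrow> (p', p'') \<in> step T a \<longrightarrow>
      (q, p') \<in> X \<times> X - semi_bisimilar A \<tau> T \<or> (q', p'') \<in> X \<times> X - semi_bisimilar A \<tau> T"
  have "(q, p) \<notin> semi_bisimilar A \<tau> T"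
  proof
    assume "(q, p) \<in> semi_bisimilar A \<tau> T"
    then show False
      using semi_bisimulation_visible[OF semi_bisimulation_semi_bisimilar a _ st] all step_in_states
      by (metis DiffD2)
  qed
  with X show "(q, p) \<in> X \<times> X - semi_bisimilar A \<tau> T" by blast
qed blast

text \<open>Each clause is the contrapositive of an apartness rule. When the silent rule fails,
  either \<open>q'\<close> is not apart from \<open>p\<close>, and \<open>p\<close> answers by
  staying put, or some \<open>p'\<close> and \<open>p''\<close> give an answering step.\<close>

lemma semi_bisimulation_compl_branching_apartness:
  assumes Q: "branching_apartness X A \<tau> T Q"
  shows "semi_bisimulation A \<tau> T (X \<times> X - Q)"
proof (rule semi_bisimulationI)
  have "sym Q" using Q unfolding branching_apartness_def by blast
  then show "sym (X \<times> X - Q)" by (auto intro!: symI dest: symD)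
next
  fix q p q' assume qp: "(q, p) \<in> X \<times> X - Q" and st: "(q, q') \<in> step T \<tau>"
  then have X: "q \<in> X" "p \<in> X" "q' \<in> X" using step_in_states by blast+
  have "(q', p) \<notin> Q \<or> (\<exists>p'\<in>X. \<exists>p''\<in>X. (p, p') \<in> (step T \<tau>)\<^sup>* \<and> (p', p'') \<in> step T \<tau> \<and>
      (q, p') \<notin> Q \<and> (q', p'') \<notin> Q)"
    using Q X qp st unfolding branching_apartness_def by (metis DiffD2)
  then show "\<exists>p'. (p, p') \<in> (step T \<tau>)\<^sup>* \<and> (q, p') \<in> X \<times> X - Q \<and>
      ((q', p') \<in> X \<times> X - Q \<or> (\<exists>p''. (p', p'') \<in> step T \<tau> \<and> (q', p'') \<in> X \<times> X - Q))"
    using X qp by blast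
next
  fix a q p q' assume a: "a \<in> A" and qp: "(q, p) \<in> X \<times> X - Q" and st: "(q, q') \<in> step T a"
  then have X: "q \<in> X" "p \<in> X" "q' \<in> X" using step_in_states by blast+
  have "\<exists>p'\<in>X. \<exists>p''\<in>X. (p, p') \<in> (step T \<tau>)\<^sup>* \<and> (p', p'') \<in> step T a \<and>
      (q, p') \<notin> Q \<and> (q', p'') \<notin> Q"
    using Q X a qp st unfolding branching_apartness_def by (metis DiffD2)
  then show "\<exists>p' p''. (p, p') \<in> (step T \<tau>)\<^sup>* \<and> (q, p') \<in> X \<times> X - Q \<and>
      (p', p'') \<in> step T a \<and> (q', p'') \<in> X \<times> X - Q"
    using X by blast
qed

text \<open>One inclusion instantiates the intersection of all apartness relations with the
  complement of semi-bisimilarity; the other holds because the complement of every apartness lies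
  inside the largest semi-branching bisimulation.\<close>

lemma branching_apart_eq: "branching_apart X A \<tau> T = X \<times> X - semi_bisimilar A \<tau> T"
proof
  show "branching_apart X A \<tau> T \<subseteq> X \<times> X - semi_bisimilar A \<tau> T"
    using branching_apartness_compl_semi_bisimilar unfolding branching_apart_def by blast
  show "X \<times> X - semi_bisimilar A \<tau> T \<subseteq> branching_apart X A \<tau> T"
    unfolding branching_apart_def
    using semi_bisimilarI[OF semi_bisimulation_compl_branching_apartness] by blast
qed

end

theorem theorem3p24:
  fixes X :: "'x set" and A :: "'l set" and \<tau> :: 'l and T :: "('x \<times> 'l \<times> 'x) set"
  assumes "lts X A \<tau> T"
  shows "proper_apartness_on X (branching_apart X A \<tau> T)"
  unfolding lts.branching_apart_eq[OF assms] proper_apartness_on_def cotrans_on_def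
  \<comment> \<open>Co-transitivity by contraposition: if \<open>x\<close>, \<open>z\<close> and
    \<open>z\<close>, \<open>y\<close> are both semi-bisimilar pairs, then so is \<open>x\<close>,
    \<open>y\<close>.\<close>
  by (auto intro!: irrefl_onI sym_onI
      intro: semi_bisimilar_refl dest: semi_bisimilar_sym semi_bisimilar_trans)

end
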